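(* Let $h=1$, let $X$ be an upwards skip-free Lévy chain on $\mathbb{Z}$ with Lévy measure $\lambda$, and let $q\ge0$. For all $n\in\mathbb{N}_0$: $$W^{(q)}(n+1)=W^{(q)}(0)+\sum_{k=1}^{n+1}W^{(q)}(n+1-k)\frac{q+\lambda((-\infty,-k])}{\lambda(\{1\})},\qquad W^{(q)}(0)=\frac1{\lambda(\{1\})},$$ and, for $\widetilde{Z^{(q)}}:=Z^{(q)}-1$, $$\widetilde{Z^{(q)}}(n+1)=(n+1)\frac{q}{\lambda(\{1\})}+\sum_{k=1}^n\widetilde{Z^{(q)}}(n+1-k)\frac{q+\lambda((-\infty,-k])}{\lambda(\{1\})},\qquad\widetilde{Z^{(q)}}(0)=0.$$
   Context: $\mathbb{N}_0=\{0,1,2,\dots\}$; empty sums are $0$. $X$ is an upwards skip-free Lévy chain on $\mathbb{Z}$: a Lévy process (càdlàg paths, $X_0=0$ a.s.) that is compound Poisson (finite Lévy measure $\lambda$, no drift, no Gaussian part) with $\lambda$ supported in $\mathbb{Z}$ and with $\lambda|_{(0,\infty)}$ having support exactly $\{1\}$ (so $\lambda(\{1\})>0$). $\psi(\beta)=\int_{\mathbb{R}}(e^{\beta x}-1)\lambda(dx)$, $\beta\ge0$, is the Laplace exponent; it is strictly convex and continuous on $[0,\infty)$ and tends to $+\infty$; $\Phi(0)$ is the largest root of $\psi|_{[0,\infty)}$, and $\Phi:[0,\infty)\to[\Phi(0),\infty)$ is the inverse of the increasing bijection $\psi:[\Phi(0),\infty)\to[0,\infty)$. Scale functions (with $h=1$):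 with $T_1:=\inf\{t\ge0:X_t\ge1\}$ and $D_1:=-\inf\{X_s:0\le s\le T_1,\ s<\infty\}$, the scale function of $X$ is $W(x)=c/\prod_{r=1}^{\lfloor x\rfloor}\mathsf{P}(D_1\le r-1)$, $x\ge0$, where $c>0$ is chosen so that $\int_0^\infty e^{-\beta x}W(x)\,dx=\frac{e^\beta-1}{\beta\psi(\beta)}$ for $\beta>\Phi(0)$. For $b\ge0$, $W_b$ denotes the scale function (defined in the same way, with the same normalization relative to its own Laplace exponent) of the upwards skip-free Lévy chain with Lévy measure $e^{bx}\lambda(dx)$, whose Laplace exponent is $\psi(\cdot+b)-\psi(b)$. For $q\ge0$ and $x\ge0$, $W^{(q)}(x):=e^{\Phi(q)\lfloor1+x\rfloor}W_{\Phi(q)}(x)$ and $Z^{(q)}(x):=1+q\int_0^{\lfloor x\rfloor}W^{(q)}(z)\,dz$. *)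

theory Defs
  imports "HOL-Probability.Probability"
begin

definition measure_support :: "real measure \<Rightarrow> real set" where
  "measure_support \<mu> = {x. \<forall>U. open U \<and> x \<in> U \<longrightarrow> 0 < emeasure \<mu> U}"

definition cadlag_on_nonneg :: "(real \<Rightarrow> real) \<Rightarrow> bool" where
  "cadlag_on_nonneg f \<longleftrightarrow>
     (\<forall>t\<ge>0. (f \<longlongrightarrow> f t) (at_right t)) \<and> (\<forall>t>0. \<exists>l. (f \<longlongrightarrow> l) (at_left t))"

text \<open>Processes are indexed by real time; only the values at times \<open>t \<ge> 0\<close> are meaningful.\<close>

definition levy_process :: "'a measure \<Rightarrow> (real \<Rightarrow> 'a \<Rightarrow> real) \<Rightarrow> bool" where
  "levy_process M X \<longleftrightarrow>
     prob_space M \<and>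
     (\<forall>t\<ge>0. X t \<in> borel_measurable M) \<and>
     (AE \<omega> in M. X 0 \<omega> = 0) \<and>
     (\<forall>\<omega>\<in>space M. cadlag_on_nonneg (\<lambda>t. X t \<omega>)) \<and>
     (\<forall>(n::nat) (t::nat \<Rightarrow> real). 0 \<le> t 0 \<and> mono_on {..n} t \<longrightarrow>
        prob_space.indep_vars M (\<lambda>_. borel) (\<lambda>i \<omega>. X (t (Suc i)) \<omega> - X (t i) \<omega>) {..<n}) \<and>
     (\<forall>s\<ge>0. \<forall>t\<ge>0. distr M borel (\<lambda>\<omega>. X (s + t) \<omega> - X s \<omega>) = distr M borel (X t))"

text \<open>The last conjunct is the Levy--Khintchine formula for a finite Levy measure \<open>\<nu>\<close> without
  drift and without Gaussian part.\<close>

definition compound_poisson_process ::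
    "'a measure \<Rightarrow> (real \<Rightarrow> 'a \<Rightarrow> real) \<Rightarrow> real measure \<Rightarrow> bool" where
  "compound_poisson_process M X \<nu> \<longleftrightarrow>
     levy_process M X \<and>
     sets \<nu> = sets borel \<and> finite_measure \<nu> \<and> emeasure \<nu> {0} = 0 \<and>
     (\<forall>t\<ge>0. \<forall>u. char (distr M borel (X t)) u
        = exp (complex_of_real t * (CLINT x|\<nu>. iexp (u * x) - 1)))"

text \<open>Below, \<open>density \<nu> (indicator {0<..})\<close> is the restriction of \<open>\<nu>\<close> to the positive half-line,
  regarded as a measure on the reals.\<close>

definition usf_levy_chain ::
    "'a measure \<Rightarrow> (real \<Rightarrow> 'a \<Rightarrow> real) \<Rightarrow> real measure \<Rightarrow> bool" where
  "usf_levy_chain M X \<nu> \<longleftrightarrow>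
     compound_poisson_process M X \<nu> \<and>
     measure_support \<nu> \<subseteq> \<int> \<and>
     measure_support (density \<nu> (indicator {0<..})) = {1}"

definition laplace_exponent :: "real measure \<Rightarrow> real \<Rightarrow> real" where
  "laplace_exponent \<nu> \<beta> = (LINT x|\<nu>. exp (\<beta> * x) - 1)"

definition largest_root :: "real measure \<Rightarrow> real" where
  "largest_root \<nu> = (GREATEST \<beta>. 0 \<le> \<beta> \<and> laplace_exponent \<nu> \<beta> = 0)"

definition Phi :: "real measure \<Rightarrow> real \<Rightarrow> real" where
  "Phi \<nu> q = the_inv_into {largest_root \<nu>..} (laplace_exponent \<nu>) q"

definition tilted :: "real \<Rightarrow> real measure \<Rightarrow> real measure" where
  "tilted b \<nu> = density \<nu> (\<lambda>x. ennreal (exp (b * x)))"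

text \<open>Extended reals: the passage time is infinite on paths that never reach level 1, and the depth
  may then be infinite as well.\<close>

definition passage_time1 :: "(real \<Rightarrow> 'a \<Rightarrow> real) \<Rightarrow> 'a \<Rightarrow> ereal" where
  "passage_time1 X \<omega> = (INF t \<in> {t. 0 \<le> t \<and> 1 \<le> X t \<omega>}. ereal t)"

definition depth1 :: "(real \<Rightarrow> 'a \<Rightarrow> real) \<Rightarrow> 'a \<Rightarrow> ereal" where
  "depth1 X \<omega> = - (INF s \<in> {s. 0 \<le> s \<and> ereal s \<le> passage_time1 X \<omega>}. ereal (X s \<omega>))"

text \<open>The paths are integer-valued only almost surely, so the event below is in general only
  measurable up to a null set; hence the completion.\<close>

definition depth1_prob :: "'a measure \<Rightarrow> (real \<Rightarrow> 'a \<Rightarrow> real) \<Rightarrow> real \<Rightarrow> real" where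
  "depth1_prob M X y = measure (completion M) {\<omega> \<in> space M. depth1 X \<omega> \<le> ereal y}"

text \<open>\<open>W\<close> is the scale function of the chain \<open>X\<close> with Levy measure \<open>\<nu>\<close>; the Laplace transform
  fixes the positive constant \<open>c\<close>. Nothing is required of \<open>W\<close> on the negative half-line.\<close>

definition is_scale_function ::
    "'a measure \<Rightarrow> (real \<Rightarrow> 'a \<Rightarrow> real) \<Rightarrow> real measure \<Rightarrow> (real \<Rightarrow> real) \<Rightarrow> bool" where
  "is_scale_function M X \<nu> W \<longleftrightarrow>
     (\<exists>c>0.
       (\<forall>x\<ge>0. W x = c / (\<Prod>r = 1..nat \<lfloor>x\<rfloor>. depth1_prob M X (real r - 1))) \<and>
       (\<forall>\<beta>>largest_root \<nu>.
          set_integrable lborel {0..} (\<lambda>x. exp (- \<beta> * x) * W x) \<and>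
          (LINT x:{0..}|lborel. exp (- \<beta> * x) * W x)
            = (exp \<beta> - 1) / (\<beta> * laplace_exponent \<nu> \<beta>)))"

text \<open>In the next definition the argument \<open>V\<close> stands for the scale function of a chain with Levy
  measure \<open>tilted (Phi \<nu> q) \<nu>\<close>.\<close>

definition q_scale_W :: "real measure \<Rightarrow> real \<Rightarrow> (real \<Rightarrow> real) \<Rightarrow> real \<Rightarrow> real" where
  "q_scale_W \<nu> q V x = exp (Phi \<nu> q * of_int \<lfloor>1 + x\<rfloor>) * V x"

definition q_scale_Z :: "real \<Rightarrow> (real \<Rightarrow> real) \<Rightarrow> real \<Rightarrow> real" where
  "q_scale_Z q Wq x = 1 + q * (LINT z:{0..of_int \<lfloor>x\<rfloor>}|lborel. Wq z)"

end

theory Submission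
  imports Defs
begin

text \<open>A scale function is constant on each \<open>[n, n + 1)\<close>, so its Laplace transform is a power series
  in \<open>z = exp (- \<gamma>)\<close>, and for large \<open>\<gamma>\<close> the normalization says
  \<open>(\<Sum>n. W\<^sup>q n * z ^ (n + 1)) = 1 / (\<psi> \<gamma> - q)\<close> (here \<open>\<psi> (\<Phi> q) = q\<close> is needed for the tilting).
  Summation by parts gives, with \<open>\<ell> k = \<nu> {..- k}\<close>,
  \<open>z * (\<psi> \<gamma> - q) = (1 - z) * (\<nu> {1} - (\<Sum>k\<ge>1. (q + \<ell> k) * z ^ k))\<close>. Hence the Cauchy product of
  \<open>\<Sum>n. W\<^sup>q n * z ^ n\<close> with \<open>\<nu> {1} - (\<Sum>k\<ge>1. (q + \<ell> k) * z ^ k)\<close> is \<open>1 / (1 - z)\<close>, and comparing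
  coefficients yields the recursion for \<open>W\<^sup>q\<close>; summing it over \<open>n\<close> yields the one for \<open>Z\<^sup>q - 1\<close>.\<close>

section \<open>Supports, power series and integrals of step functions\<close>

text \<open>The complement of the support is the union of all open null sets. By the Lindelof
  property countably many of them already cover it, so it is itself a null set.\<close>

lemma AE_in_measure_support:
  assumes "sets \<mu> = sets borel"
  shows "AE x in \<mu>. x \<in> measure_support \<mu>"
proof -
  define F where "F = {U. open U \<and> emeasure \<mu> U = 0}"
  obtain F' where F': "F' \<subseteq> F" "countable F'" "\<Union>F' = \<Union>F"
    by (rule Lindelof[of F]) (auto simp: F_def)
  have "(\<Union>U\<in>F'. U) \<in> null_sets \<mu>"
  proof (rule null_sets_UN'[OF F'(2)])
    fix U assume "U \<in> F'"
    with F'(1) have "open U" "emeasure \<mu> U = 0" by (auto simp: F_def)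
    with assms show "U \<in> null_sets \<mu>" by (auto simp: null_sets_def)
  qed
  also have "(\<Union>U\<in>F'. U) = - measure_support \<mu>"
    by (auto simp: F'(3) F_def measure_support_def)
  finally show ?thesis
    by (rule AE_I') auto
qed

text \<open>Comparison of coefficients for series known only at positive arguments, as
  \<open>z = exp (- \<gamma>)\<close> is. By strong induction the coefficients below
  \<open>n\<close> vanish, so dividing by \<open>z ^ n\<close> leaves a series with constant term
  \<open>d n\<close> that is zero on \<open>(0, r)\<close>. Convergence at positive points extends
  to the whole disc, hence the series is continuous at 0 and its right limit there gives
  \<open>d n = 0\<close>.\<close>

lemma powser_zero_right_imp_coeff_zero:
  fixes d :: "nat \<Rightarrow> real"
  assumes r: "0 < r" and d: "\<And>z. 0 < z \<Longrightarrow> z < r \<Longrightarrow> (\<lambda>n. d n * z ^ n) sums 0"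
  shows "d n = 0"
proof (induction n rule: less_induct)
  case (less n)
  have tail: "(\<lambda>i. d (i + n) * z ^ i) sums 0" if z: "0 < z" "z < r" for z
  proof -
    have "(\<lambda>i. d (i + n) * z ^ (i + n)) sums 0"
      using sums_iff_shift'[of "\<lambda>i. d i * z ^ i" n 0] d[OF z] less by simp
    then have "(\<lambda>i. inverse (z ^ n) * (d (i + n) * z ^ (i + n))) sums (inverse (z ^ n) * 0)"
      by (rule sums_mult)
    with z show ?thesis by (simp add: power_add field_simps)
  qed
  have sm: "summable (\<lambda>i. d (i + n) * z ^ i)" if z: "norm z < r" for z
  proof -
    obtain y where "norm z < y" "y < r" using dense[OF z] by blast
    moreover from this have "0 < y"
      using norm_ge_zero[of z] by linarith
    ultimately have "summable (\<lambda>i. d (i + n) * y ^ i)" "norm z < norm y"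
      using sums_summable[OF tail[of y]] by simp_all
    then show ?thesis
      by (rule powser_inside)
  qed
  have "((\<lambda>z. \<Sum>i. d (i + n) * z ^ i) \<longlongrightarrow> d (0 + n)) (at 0)"
    by (rule powser_limit_0[OF r]) (use sm in \<open>auto intro: summable_sums\<close>)
  then have "((\<lambda>z. \<Sum>i. d (i + n) * z ^ i) \<longlongrightarrow> d n) (at_right 0)"
    by (auto intro: tendsto_mono[OF at_le])
  moreover have "eventually (\<lambda>z. (\<Sum>i. d (i + n) * z ^ i) = 0) (at_right 0)"
    using eventually_at_right_less[of 0] order_tendstoD(2)[OF tendsto_ident_at r]
    by eventually_elim (use tail in \<open>auto simp: sums_iff\<close>)
  ultimately have "((\<lambda>z::real. 0) \<longlongrightarrow> d n) (at_right 0)"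
    by (rule Lim_transform_eventually)
  then show ?case
    by (simp add: tendsto_const_iff)
qed

text \<open>On each cell \<open>[i, i + 1)\<close> the integrand is a constant multiple of
  \<open>h\<close>, and \<open>H\<close> is an antiderivative of \<open>h\<close>. The case
  \<open>h x = exp (- \<beta> * x)\<close> serves the Laplace transform, the case
  \<open>h x = 1\<close> serves \<open>Z\<close>.\<close>

lemma floor_step_integral:
  fixes g h H :: "real \<Rightarrow> real" and w :: "nat \<Rightarrow> real"
  assumes g: "\<And>x. 0 \<le> x \<Longrightarrow> g x = h x * w (nat \<lfloor>x\<rfloor>)"
    and H: "\<And>x. (H has_real_derivative h x) (at x)" and h: "\<And>x. isCont h x"
  shows "(LINT x:{0..real n}|lborel. g x) = (\<Sum>i<n. (H (real i + 1) - H (real i)) * w i)"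
proof -
  \<comment> \<open>The integrand may jump at integers, so the cells have to be half-open, while the
    fundamental theorem and the claim concern closed intervals. Single points, which have integral
    0, are removed or added to pass between the two.\<close>
  have null: "has_bochner_integral lborel (\<lambda>x. indicator {a} x *\<^sub>R c) 0" for a c :: real
    using has_bochner_integral_scaleR_left[OF has_bochner_integral_real_indicator[of "{a}" lborel], of c]
    by simp
  have cell: "has_bochner_integral lborel (\<lambda>x. indicator {real i..<real (Suc i)} x *\<^sub>R g x)
      ((H (real i + 1) - H (real i)) * w i)" for i
  proof -
    have "has_bochner_integral lborel (\<lambda>x. indicator {real i..real i + 1} x *\<^sub>R h x)
        (H (real i + 1) - H (real i))"
      by (rule has_bochner_integral_FTC_Icc)
         (use H h in \<open>auto simp: has_real_derivative_iff_has_vector_derivative[symmetric]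
            intro: has_field_derivative_at_within continuous_at_imp_continuous_on\<close>)
    from has_bochner_integral_diff[OF this null[of "real i + 1" "h (real i + 1)"]]
    have "has_bochner_integral lborel (\<lambda>x. indicator {real i..real i + 1} x *\<^sub>R h x
        - indicator {real i + 1} x *\<^sub>R h (real i + 1)) (H (real i + 1) - H (real i))" by simp
    also have "(\<lambda>x. indicator {real i..real i + 1} x *\<^sub>R h x
        - indicator {real i + 1} x *\<^sub>R h (real i + 1))
        = (\<lambda>x. indicator {real i..<real i + 1} x *\<^sub>R h x)"
      by (auto simp: fun_eq_iff split: split_indicator)
    finally have "has_bochner_integral lborel (\<lambda>x. indicator {real i..<real i + 1} x *\<^sub>R h x)
        (H (real i + 1) - H (real i))" .
    from has_bochner_integral_mult_left[OF this, of "w i"]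
    have *: "has_bochner_integral lborel (\<lambda>x. indicator {real i..<real i + 1} x *\<^sub>R h x * w i)
        ((H (real i + 1) - H (real i)) * w i)" by simp
    have eq: "g x = h x * w i" if "real i \<le> x" "x < real i + 1" for x
    proof -
      have "\<lfloor>x\<rfloor> = int i" using that by (simp add: floor_eq_iff)
      then show ?thesis using that by (simp add: g)
    qed
    note *
    also have "(\<lambda>x. indicator {real i..<real i + 1} x *\<^sub>R h x * w i)
        = (\<lambda>x. indicator {real i..<real (Suc i)} x *\<^sub>R g x)"
      using eq by (auto simp: fun_eq_iff add.commute split: split_indicator)
    finally show ?thesis .
  qed
  have "has_bochner_integral lborel (\<lambda>x. indicator {0..<real n} x *\<^sub>R g x)
      (\<Sum>i<n. (H (real i + 1) - H (real i)) * w i)"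
  proof (induction n)
    case (Suc n)
    have "indicator {0..<real n} x *\<^sub>R g x + indicator {real n..<real (Suc n)} x *\<^sub>R g x
        = indicator {0..<real (Suc n)} x *\<^sub>R g x" for x
      by (auto split: split_indicator)
    with has_bochner_integral_add[OF Suc cell[of n]] show ?case
      by simp
  qed (simp add: has_bochner_integral_zero)
  from has_bochner_integral_add[OF this null[of "real n" "g (real n)"]]
  have "has_bochner_integral lborel
      (\<lambda>x. indicator {0..<real n} x *\<^sub>R g x + indicator {real n} x *\<^sub>R g (real n))
      (\<Sum>i<n. (H (real i + 1) - H (real i)) * w i)" by simp
  also have "(\<lambda>x. indicator {0..<real n} x *\<^sub>R g x + indicator {real n} x *\<^sub>R g (real n))
      = (\<lambda>x. indicator {0..real n} x *\<^sub>R g x)"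
    by (auto simp: fun_eq_iff split: split_indicator)
  finally show ?thesis
    by (simp add: set_lebesgue_integral_def has_bochner_integral_integral_eq)
qed

text \<open>The partial sums are the integrals over \<open>[0, n]\<close>, and these converge to the
  integral over the half-line by integrability.\<close>

lemma floor_step_laplace_sums:
  fixes V :: "real \<Rightarrow> real"
  assumes V: "\<And>x. 0 \<le> x \<Longrightarrow> V x = V (real (nat \<lfloor>x\<rfloor>))" and \<beta>: "\<beta> \<noteq> 0"
    and int: "set_integrable lborel {0..} (\<lambda>x. exp (- \<beta> * x) * V x)"
  shows "(\<lambda>n. (1 - exp (- \<beta>)) / \<beta> * exp (- \<beta> * real n) * V (real n))
           sums (LINT x:{0..}|lborel. exp (- \<beta> * x) * V x)"
proof -
  have un: "(\<Union>n. {0..real n}) = {0..}"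
    by (auto intro: real_arch_simple)
  have "(\<lambda>n. LINT x:{0..real n}|lborel. exp (- \<beta> * x) * V x)
      \<longlonglongrightarrow> (LINT x:(\<Union>n. {0..real n})|lborel. exp (- \<beta> * x) * V x)"
    by (rule set_integral_cont_up) (use int un in \<open>auto simp: incseq_def\<close>)
  moreover have "(LINT x:{0..real n}|lborel. exp (- \<beta> * x) * V x)
      = (\<Sum>i<n. (1 - exp (- \<beta>)) / \<beta> * exp (- \<beta> * real i) * V (real i))" for n
  proof -
    have "(LINT x:{0..real n}|lborel. exp (- \<beta> * x) * V x)
      = (\<Sum>i<n. (- exp (- \<beta> * (real i + 1)) / \<beta> - - exp (- \<beta> * real i) / \<beta>) * V (real i))"
    proof (rule floor_step_integral[where h = "\<lambda>x. exp (- \<beta> * x)"])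
      show "exp (- \<beta> * x) * V x = exp (- \<beta> * x) * V (real (nat \<lfloor>x\<rfloor>))" if "0 \<le> x" for x
        using V[OF that] by (rule arg_cong)
    qed (use \<beta> in \<open>auto intro!: derivative_eq_intros\<close>)
    also have "\<dots> = (\<Sum>i<n. (1 - exp (- \<beta>)) / \<beta> * exp (- \<beta> * real i) * V (real i))"
    proof (intro sum.cong refl)
      fix i
      have "exp (- \<beta> * (real i + 1)) = exp (- \<beta> * real i) * exp (- \<beta>)"
        unfolding exp_add[symmetric] by (simp add: distrib_left)
      moreover have "(- (a * c) / \<beta> - - a / \<beta>) * v = (1 - c) / \<beta> * a * v" for a c v :: real
        using \<beta> by (simp add: field_simps)
      ultimately show "(- exp (- \<beta> * (real i + 1)) / \<beta> - - exp (- \<beta> * real i) / \<beta>) * V (real i)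
          = (1 - exp (- \<beta>)) / \<beta> * exp (- \<beta> * real i) * V (real i)"
        by (simp only:)
    qed
    finally show ?thesis .
  qed
  ultimately show ?thesis
    by (simp add: sums_def un)
qed

section \<open>The Laplace exponent, its largest root and its inverse\<close>

text \<open>Separates the analysis of the Levy measure from the process. The conditions on supports
  become almost-everywhere statements, the form in which integrals use them.\<close>

locale usf_levy_measure = finite_measure \<nu> for \<nu> :: "real measure" +
  assumes sets_nu [measurable_cong, simp]: "sets \<nu> = sets borel"
    and AE_Ints: "AE x in \<nu>. x \<in> \<int>"
    and AE_le_1: "AE x in \<nu>. x \<le> 1"
    and measure_1_pos: "0 < measure \<nu> {1}"
begin

lemma space_nu [simp]: "space \<nu> = UNIV"
  using sets_eq_imp_space_eq[OF sets_nu] by simp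

lemma integrable_indicator_1: "integrable \<nu> (indicator {1} :: real \<Rightarrow> real)"
  by (rule integrable_real_indicator) (auto simp: less_top[symmetric])

text \<open>Since jumps are at most 1 almost everywhere, \<open>\<beta> * x \<le> K\<close>. The
  bound is uniform in \<open>\<beta>\<close>, so it also dominates in the proof of
  continuity.\<close>

lemma AE_exp_bound:
  assumes "0 \<le> \<beta>" "\<beta> \<le> K"
  shows "AE x in \<nu>. norm (exp (\<beta> * x) - 1) \<le> exp K + 1"
  using AE_le_1
proof eventually_elim
  case (elim x)
  have "\<beta> * x \<le> K"
    using mult_left_mono[OF elim assms(1)] assms(2) by simp
  then have "exp (\<beta> * x) \<le> exp K" by simp
  then show ?case
    using exp_gt_zero[of "\<beta> * x"] by (simp only: real_norm_def)
qed

lemma integrable_exp_minus_1: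
  assumes "0 \<le> \<beta>"
  shows "integrable \<nu> (\<lambda>x. exp (\<beta> * x) - 1)"
  by (rule integrable_const_bound[OF AE_exp_bound[OF assms order_refl]]) measurable

lemma convex_on_laplace_exponent: "convex_on {0..} (laplace_exponent \<nu>)"
proof (rule convex_onI)
  fix t s u :: real
  assume t: "0 < t" "t < 1" and su: "s \<in> {0..}" "u \<in> {0..}"
  have "laplace_exponent \<nu> ((1 - t) *\<^sub>R s + t *\<^sub>R u)
      \<le> (LINT x|\<nu>. (1 - t) * (exp (s * x) - 1) + t * (exp (u * x) - 1))"
    unfolding laplace_exponent_def
  proof (rule integral_mono)
    show "integrable \<nu> (\<lambda>x. exp (((1 - t) *\<^sub>R s + t *\<^sub>R u) * x) - 1)"
      using t su by (intro integrable_exp_minus_1) simp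
    show "integrable \<nu> (\<lambda>x. (1 - t) * (exp (s * x) - 1) + t * (exp (u * x) - 1))"
      using su by (intro Bochner_Integration.integrable_add integrable_mult_right
        integrable_exp_minus_1) auto
    fix x
    have "exp ((1 - t) *\<^sub>R (s * x) + t *\<^sub>R (u * x)) \<le> (1 - t) * exp (s * x) + t * exp (u * x)"
      using t by (intro convex_onD[OF exp_convex]) auto
    then show "exp (((1 - t) *\<^sub>R s + t *\<^sub>R u) * x) - 1
        \<le> (1 - t) * (exp (s * x) - 1) + t * (exp (u * x) - 1)"
      by (simp add: algebra_simps)
  qed
  also have "\<dots> = (1 - t) * laplace_exponent \<nu> s + t * laplace_exponent \<nu> u"
    unfolding laplace_exponent_def
    using su integrable_exp_minus_1[of s] integrable_exp_minus_1[of u] by simp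
  finally show "laplace_exponent \<nu> ((1 - t) *\<^sub>R s + t *\<^sub>R u)
      \<le> (1 - t) * laplace_exponent \<nu> s + t * laplace_exponent \<nu> u" .
qed simp

lemma continuous_on_laplace_exponent: "continuous_on {0..} (laplace_exponent \<nu>)"
proof (rule continuous_on_sequentiallyI)
  fix u :: "nat \<Rightarrow> real" and a
  assume u: "\<forall>n. u n \<in> {0..}" and lim: "u \<longlonglongrightarrow> a"
  obtain K where K: "\<And>n. norm (u n) \<le> K"
    using convergent_imp_Bseq[OF convergentI[OF lim]] unfolding Bseq_def by auto
  show "(\<lambda>n. laplace_exponent \<nu> (u n)) \<longlonglongrightarrow> laplace_exponent \<nu> a"
    unfolding laplace_exponent_def
  proof (rule integral_dominated_convergence)
    show "integrable \<nu> (\<lambda>_. exp K + 1)" by simp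
    show "AE x in \<nu>. (\<lambda>n. exp (u n * x) - 1) \<longlonglongrightarrow> exp (a * x) - 1"
      by (intro always_eventually allI tendsto_intros lim)
    show "AE x in \<nu>. norm (exp (u n * x) - 1) \<le> exp K + 1" for n
      using u K[of n] by (intro AE_exp_bound) auto
  qed measurable
qed

text \<open>Keeps only the atom at 1 and bounds the exponential below by 0 elsewhere.\<close>

lemma laplace_exponent_ge:
  assumes "0 \<le> \<beta>"
  shows "exp \<beta> * measure \<nu> {1} - measure \<nu> UNIV \<le> laplace_exponent \<nu> \<beta>"
proof -
  have "exp \<beta> * measure \<nu> {1} - measure \<nu> UNIV = (LINT x|\<nu>. exp \<beta> * indicator {1} x - 1)"
    by (subst Bochner_Integration.integral_diff) (auto simp: less_top[symmetric])
  also have "\<dots> \<le> laplace_exponent \<nu> \<beta>"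
    unfolding laplace_exponent_def
    using assms
    by (intro integral_mono integrable_exp_minus_1 Bochner_Integration.integrable_diff
        integrable_mult_right integrable_indicator_1) (auto split: split_indicator)
  finally show ?thesis .
qed

lemma laplace_exponent_large:
  obtains B where "\<And>\<beta>. B < \<beta> \<Longrightarrow> C < laplace_exponent \<nu> \<beta>"
proof
  \<comment> \<open>The threshold comes from the lower bound \<open>laplace_exponent_ge\<close>
    together with \<open>exp \<beta> \<ge> 1 + \<beta>\<close>.\<close>
  fix \<beta> assume \<beta>: "max 0 ((\<bar>C\<bar> + measure \<nu> UNIV) / measure \<nu> {1}) < \<beta>"
  have "\<bar>C\<bar> + measure \<nu> UNIV < \<beta> * measure \<nu> {1}"
    using \<beta> measure_1_pos by (simp add: pos_divide_less_eq)
  also have "\<dots> \<le> exp \<beta> * measure \<nu> {1}"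
    using measure_1_pos exp_ge_add_one_self[of \<beta>] by (intro mult_right_mono) linarith+
  finally show "C < laplace_exponent \<nu> \<beta>"
    using laplace_exponent_ge[of \<beta>] \<beta> by linarith
qed

text \<open>\<open>GREATEST\<close> is meaningful only once a maximum exists: the set of nonnegative
  roots contains 0, is closed by continuity and bounded by growth, hence compact. A value that is
  not positive beyond the maximum would, by growth and the intermediate value theorem, produce a
  still larger root.\<close>

lemma largest_root:
  shows largest_root_nonneg: "0 \<le> largest_root \<nu>"
    and laplace_exponent_largest_root: "laplace_exponent \<nu> (largest_root \<nu>) = 0"
    and laplace_exponent_pos: "\<And>\<beta>. largest_root \<nu> < \<beta> \<Longrightarrow> 0 < laplace_exponent \<nu> \<beta>"
proof -
  let ?R = "{\<beta>. 0 \<le> \<beta> \<and> laplace_exponent \<nu> \<beta> = 0}"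
  obtain B where B: "\<And>\<beta>. B < \<beta> \<Longrightarrow> 0 < laplace_exponent \<nu> \<beta>"
    using laplace_exponent_large by metis
  have "closed ({0..} \<inter> laplace_exponent \<nu> -` {0})"
    by (intro continuous_closed_preimage continuous_on_laplace_exponent) auto
  also have "{0..} \<inter> laplace_exponent \<nu> -` {0} = ?R" by auto
  finally have "closed ?R" .
  moreover have sub: "?R \<subseteq> {0..B}"
    using B by (force simp: not_less[symmetric])
  ultimately have "compact ?R"
    by (metis bounded_closed_interval bounded_subset compact_eq_bounded_closed)
  moreover have "0 \<in> ?R" by (simp add: laplace_exponent_def)
  ultimately obtain r where r: "r \<in> ?R" "\<And>\<beta>. \<beta> \<in> ?R \<Longrightarrow> \<beta> \<le> r"
    using compact_attains_sup[of ?R] by blast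
  have eq: "largest_root \<nu> = r"
    unfolding largest_root_def using r by (intro Greatest_equality) auto
  show "0 \<le> largest_root \<nu>" "laplace_exponent \<nu> (largest_root \<nu>) = 0"
    using r(1) by (auto simp: eq)
  fix \<beta> assume "largest_root \<nu> < \<beta>"
  then have \<beta>: "r < \<beta>" by (simp add: eq)
  show "0 < laplace_exponent \<nu> \<beta>"
  proof (rule ccontr)
    assume neg: "\<not> 0 < laplace_exponent \<nu> \<beta>"
    define c where "c = max \<beta> (B + 1)"
    have "0 < laplace_exponent \<nu> c" by (rule B) (simp add: c_def)
    moreover have "continuous_on {\<beta>..c} (laplace_exponent \<nu>)"
      using \<beta> r(1) by (intro continuous_on_subset[OF continuous_on_laplace_exponent]) auto
    ultimately obtain y where "\<beta> \<le> y" "laplace_exponent \<nu> y = 0"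
      using IVT'[of "laplace_exponent \<nu>" \<beta> 0 c] neg max.cobounded1[of \<beta> "B + 1"]
      unfolding c_def[symmetric] by force
    with r(1) r(2)[of y] \<beta> show False by auto
  qed
qed

text \<open>Plain convexity suffices: \<open>s\<close> lies between the largest root
  \<open>r\<close> and \<open>u\<close>, with weight \<open>t < 1\<close> on \<open>u\<close>. As
  the exponent is 0 at \<open>r\<close> and positive at \<open>u\<close>, its value at
  \<open>s\<close> is at most \<open>t\<close> times that at \<open>u\<close>.\<close>

lemma laplace_exponent_strict_mono:
  "strict_mono_on {largest_root \<nu>..} (laplace_exponent \<nu>)"
proof (rule strict_mono_onI)
  fix s u assume su: "s \<in> {largest_root \<nu>..}" "u \<in> {largest_root \<nu>..}" "s < u"
  define r where "r = largest_root \<nu>"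
  define t where "t = (s - r) / (u - r)"
  have t: "0 \<le> t" "t < 1" using su by (auto simp: t_def r_def)
  have "t * (u - r) = s - r" using su by (simp add: t_def r_def)
  then have "s = (1 - t) *\<^sub>R r + t *\<^sub>R u" by (simp add: algebra_simps)
  then have "laplace_exponent \<nu> s \<le> (1 - t) * laplace_exponent \<nu> r + t * laplace_exponent \<nu> u"
    using convex_onD[OF convex_on_laplace_exponent, of t r u] t su largest_root_nonneg
    by (simp add: r_def)
  also have "\<dots> < laplace_exponent \<nu> u"
    using t su laplace_exponent_pos[of u] by (simp add: r_def laplace_exponent_largest_root)
  finally show "laplace_exponent \<nu> s < laplace_exponent \<nu> u" .
qed

text \<open>\<open>the_inv_into\<close> inverts only an injective map at an attained value. Strict
  monotonicity gives the first; the second follows from the intermediate value theorem between the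
  largest root, where the exponent is \<open>0 \<le> q\<close>, and a point where it exceeds
  \<open>q\<close>.\<close>

lemma Phi:
  assumes "0 \<le> q"
  shows Phi_nonneg: "0 \<le> Phi \<nu> q" and laplace_exponent_Phi: "laplace_exponent \<nu> (Phi \<nu> q) = q"
proof -
  let ?r = "largest_root \<nu>"
  have inj: "inj_on (laplace_exponent \<nu>) {?r..}"
    using laplace_exponent_strict_mono by (rule strict_mono_on_imp_inj_on)
  obtain B where B: "\<And>\<beta>. B < \<beta> \<Longrightarrow> q < laplace_exponent \<nu> \<beta>"
    using laplace_exponent_large by metis
  define c where "c = max ?r (B + 1)"
  have "q < laplace_exponent \<nu> c" by (rule B) (simp add: c_def)
  moreover have "continuous_on {?r..c} (laplace_exponent \<nu>)"
    using largest_root_nonneg by (intro continuous_on_subset[OF continuous_on_laplace_exponent]) auto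
  ultimately obtain y where "?r \<le> y" "laplace_exponent \<nu> y = q"
    using IVT'[of "laplace_exponent \<nu>" ?r q c] assms
    by (auto simp: c_def laplace_exponent_largest_root)
  then have q: "q \<in> laplace_exponent \<nu> ` {?r..}" by auto
  show "laplace_exponent \<nu> (Phi \<nu> q) = q"
    unfolding Phi_def by (rule f_the_inv_into_f[OF inj q])
  have "Phi \<nu> q \<in> {?r..}"
    unfolding Phi_def by (rule the_inv_into_into[OF inj q order_refl])
  then show "0 \<le> Phi \<nu> q"
    using largest_root_nonneg by simp
qed

lemma laplace_exponent_tilted:
  assumes "0 \<le> b" "0 \<le> \<beta>"
  shows "laplace_exponent (tilted b \<nu>) \<beta> = laplace_exponent \<nu> (\<beta> + b) - laplace_exponent \<nu> b"
proof -
  have "laplace_exponent (tilted b \<nu>) \<beta> = (LINT x|\<nu>. exp (b * x) *\<^sub>R (exp (\<beta> * x) - 1))"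
    unfolding laplace_exponent_def tilted_def by (rule integral_density) auto
  also have "\<dots> = (LINT x|\<nu>. (exp ((\<beta> + b) * x) - 1) - (exp (b * x) - 1))"
    by (simp add: algebra_simps exp_add)
  also have "\<dots> = laplace_exponent \<nu> (\<beta> + b) - laplace_exponent \<nu> b"
    unfolding laplace_exponent_def
    using assms by (intro Bochner_Integration.integral_diff integrable_exp_minus_1) auto
  finally show ?thesis .
qed

section \<open>Generating function of the tails of the Levy measure\<close>

text \<open>Summation by parts for a single jump size. For \<open>x = 1\<close> both sides are 0;
  for \<open>x = - m\<close> the left side is the finite geometric sum of \<open>z ^ k\<close>,
  \<open>k = 1, ..., m\<close>, with \<open>z = exp (- \<beta>)\<close>.\<close>

lemma exp_minus_1_tail_sums:
  fixes x :: real
  assumes \<beta>: "0 < \<beta>" and x: "x \<in> \<int>" "x \<le> 1"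
  shows "(\<lambda>k. indicator {..- real (Suc k)} x * exp (- \<beta>) ^ Suc k)
           sums (indicator {1} x - (exp (\<beta> * x) - 1) / (exp \<beta> - 1))"
proof (cases "x = 1")
  case True
  with \<beta> show ?thesis by simp
next
  case False
  obtain j where "x = of_int j" using x(1) by (rule Ints_cases)
  with x(2) False have "x = - real (nat (- j))" by simp
  then obtain m where m: "x = - real m" by blast
  define z where "z = exp (- \<beta>)"
  have z: "0 < z" "z < 1" "exp \<beta> = 1 / z" "exp (\<beta> * x) = z ^ m"
    using \<beta> by (auto simp: z_def m exp_minus field_simps exp_of_nat_mult[symmetric])
  have "(\<lambda>k. indicator {..- real (Suc k)} x * z ^ Suc k)
      sums (\<Sum>k<m. indicator {..- real (Suc k)} x * z ^ Suc k)"
    by (rule sums_finite) (auto simp: m)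
  also have "(\<Sum>k<m. indicator {..- real (Suc k)} x * z ^ Suc k) = z * (\<Sum>k<m. z ^ k)"
    by (simp add: sum_distrib_left m)
  also have "\<dots> = (1 - z ^ m) / (1 / z - 1)"
    using z by (simp add: sum_gp_strict field_simps)
  also have "\<dots> = indicator {1} x - (exp (\<beta> * x) - 1) / (exp \<beta> - 1)"
    using False z by (simp add: diff_divide_distrib)
  finally show ?thesis by (simp add: z_def)
qed

text \<open>Integrates the identity for single jumps. Sum and integral may be exchanged because the
  terms are dominated by the geometric series with ratio \<open>exp (- \<beta>)\<close> times the
  total mass.\<close>

lemma tail_power_series_sums:
  assumes \<beta>: "0 < \<beta>"
  shows "(\<lambda>k. measure \<nu> {..- real (Suc k)} * exp (- \<beta>) ^ Suc k)
           sums (measure \<nu> {1} - laplace_exponent \<nu> \<beta> / (exp \<beta> - 1))"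
proof -
  let ?f = "\<lambda>k x. indicator {..- real (Suc k)} x * exp (- \<beta>) ^ Suc k :: real"
  have intf: "integrable \<nu> (?f k)" for k
    by (intro integrable_mult_left integrable_real_indicator) (auto simp: less_top[symmetric])
  have z: "norm (exp (- \<beta>)) < 1" using \<beta> by simp
  have int: "(LINT x|\<nu>. ?f k x) = measure \<nu> {..- real (Suc k)} * exp (- \<beta>) ^ Suc k" for k
    by simp
  have "(\<lambda>k. LINT x|\<nu>. ?f k x) sums (LINT x|\<nu>. (\<Sum>k. ?f k x))"
  proof (rule sums_integral[OF intf])
    show "AE x in \<nu>. summable (\<lambda>k. norm (?f k x))"
      using AE_Ints AE_le_1
    proof eventually_elim
      case (elim x)
      then have "summable (\<lambda>k. ?f k x)"
        using exp_minus_1_tail_sums[OF \<beta>] by (auto simp: sums_iff)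
      then show ?case by simp
    qed
    show "summable (\<lambda>k. LINT x|\<nu>. norm (?f k x))"
    proof (rule summable_comparison_test')
      show "summable (\<lambda>k. measure \<nu> UNIV * exp (- \<beta>) ^ Suc k)"
        using z by (intro summable_mult) (simp del: power_Suc add: summable_Suc_iff)
      show "norm (LINT x|\<nu>. norm (?f k x)) \<le> measure \<nu> UNIV * exp (- \<beta>) ^ Suc k" for k
        using finite_measure_mono[of "{..- real (Suc k)}" UNIV]
        by (simp add: int abs_mult mult_right_mono)
    qed
  qed
  also have "(LINT x|\<nu>. (\<Sum>k. ?f k x))
      = (LINT x|\<nu>. indicator {1} x - (exp (\<beta> * x) - 1) / (exp \<beta> - 1))"
  proof (rule integral_cong_AE)
    show "AE x in \<nu>. (\<Sum>k. ?f k x) = indicator {1} x - (exp (\<beta> * x) - 1) / (exp \<beta> - 1)"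
      using AE_Ints AE_le_1
      by eventually_elim (use exp_minus_1_tail_sums[OF \<beta>] in \<open>auto simp: sums_iff\<close>)
  qed measurable
  also have "\<dots> = measure \<nu> {1} - laplace_exponent \<nu> \<beta> / (exp \<beta> - 1)"
    unfolding laplace_exponent_def
    using \<beta> by (subst Bochner_Integration.integral_diff)
      (auto intro!: integrable_exp_minus_1 integrable_indicator_1 integrable_divide)
  finally show ?thesis by (simp only: int)
qed

end

section \<open>Renewal equations\<close>

text \<open>The product of the series for \<open>l - g z\<close> and \<open>f z\<close> is the
  geometric series, so every coefficient of their Cauchy product is 1.\<close>

lemma renewal_equation_from_power_series:
  fixes w a :: "nat \<Rightarrow> real"
  assumes r: "0 < r"
    and w: "\<And>z. 0 < z \<Longrightarrow> z < r \<Longrightarrow> (\<lambda>n. w n * z ^ n) sums f z"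
    and a: "\<And>z. 0 < z \<Longrightarrow> z < r \<Longrightarrow> (\<lambda>k. a k * z ^ Suc k) sums g z"
    and fg: "\<And>z. 0 < z \<Longrightarrow> z < r \<Longrightarrow> (l - g z) * f z = 1 / (1 - z)"
  shows "l * w n = 1 + (\<Sum>k<n. a k * w (n - Suc k))"
proof -
  define b where "b k = (case k of 0 \<Rightarrow> l | Suc j \<Rightarrow> - a j)" for k
  have b: "(\<lambda>k. b k * z ^ k) sums (l - g z)" if "0 < z" "z < r" for z
  proof -
    have "(\<lambda>k. b (Suc k) * z ^ Suc k) sums (- g z)"
      using sums_minus[OF a[OF that]] by (simp add: b_def)
    then have "(\<lambda>k. b k * z ^ k) sums (- g z + b 0 * z ^ 0)"
      by (rule sums_Suc)
    then show ?thesis by (simp add: b_def)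
  qed
  have conv: "(\<Sum>i\<le>n. b i * w (n - i)) = l * w n - (\<Sum>k<n. a k * w (n - Suc k))" for n
    by (simp add: sum.atMost_shift b_def sum_negf)
  \<comment> \<open>The bound 1 is for the geometric series. The intermediate point \<open>y\<close>
    chosen below turns convergence at \<open>y\<close> into absolute convergence at
    \<open>z\<close>, which the Cauchy product needs.\<close>
  have "(\<lambda>n. ((\<Sum>i\<le>n. b i * w (n - i)) - 1) * z ^ n) sums 0" if z: "0 < z" "z < min r 1" for z
  proof -
    obtain y where y: "z < y" "y < r" using dense[of z r] z by auto
    have abs: "summable (\<lambda>k. norm (c k * z ^ k))"
      if "\<And>z. 0 < z \<Longrightarrow> z < r \<Longrightarrow> (\<lambda>n. c n * z ^ n) sums h z" for c h
      by (rule powser_insidea[of c y]) (use that[of y] y z in \<open>auto intro: sums_summable\<close>)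
    have "(\<lambda>n. \<Sum>i\<le>n. (b i * z ^ i) * (w (n - i) * z ^ (n - i)))
        sums ((\<Sum>k. b k * z ^ k) * (\<Sum>k. w k * z ^ k))"
      by (rule Cauchy_product_sums[OF abs[OF b] abs[OF w]])
    also have "(\<Sum>k. b k * z ^ k) * (\<Sum>k. w k * z ^ k) = 1 / (1 - z)"
      using b[of z] w[of z] fg[of z] z by (simp add: sums_iff)
    also have "(\<lambda>n. \<Sum>i\<le>n. (b i * z ^ i) * (w (n - i) * z ^ (n - i)))
        = (\<lambda>n. (\<Sum>i\<le>n. b i * w (n - i)) * z ^ n)"
      unfolding sum_distrib_right
      by (intro ext sum.cong refl) (simp add: power_add[symmetric] mult_ac)
    finally have "(\<lambda>n. (\<Sum>i\<le>n. b i * w (n - i)) * z ^ n - z ^ n) sums (1 / (1 - z) - 1 / (1 - z))"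
      using z by (intro sums_diff geometric_sums) auto
    then show ?thesis by (simp add: left_diff_distrib)
  qed
  from powser_zero_right_imp_coeff_zero[of "min r 1", OF _ this]
  have "(\<Sum>i\<le>n. b i * w (n - i)) - 1 = 0" using r by auto
  then show ?thesis by (simp add: conv)
qed

lemma renewal_equation_partial_sums:
  fixes w a :: "nat \<Rightarrow> real"
  assumes "\<And>n. l * w n = 1 + (\<Sum>k<n. a k * w (n - Suc k))"
  shows "l * (\<Sum>i<n. w i) = real n + (\<Sum>k<n. a k * (\<Sum>i<n - Suc k. w i))"
proof (induction n)
  case (Suc n)
  have "l * (\<Sum>i<Suc n. w i)
      = real (Suc n) + (\<Sum>k<n. a k * ((\<Sum>i<n - Suc k. w i) + w (n - Suc k)))"
    by (simp add: distrib_left Suc.IH assms[of n] sum.distrib)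
  also have "(\<Sum>k<n. a k * ((\<Sum>i<n - Suc k. w i) + w (n - Suc k)))
      = (\<Sum>k<n. a k * (\<Sum>i<n - k. w i))"
  proof (intro sum.cong refl)
    fix k assume "k \<in> {..<n}"
    then have "n - k = Suc (n - Suc k)" by auto
    then show "a k * ((\<Sum>i<n - Suc k. w i) + w (n - Suc k)) = a k * (\<Sum>i<n - k. w i)" by simp
  qed
  \<comment> \<open>The term \<open>k = n\<close> on the right of the claim for \<open>Suc n\<close>
    has an empty inner sum.\<close>
  finally show ?case by simp
qed simp

section \<open>Power series of the scale functions\<close>

lemma is_scale_function_floor:
  assumes "is_scale_function M X \<nu> W" "0 \<le> x"
  shows "W x = W (real (nat \<lfloor>x\<rfloor>))"
  using assms by (auto simp: is_scale_function_def)

text \<open>This is the normalization of \<open>V\<close> at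
  \<open>\<beta> = \<gamma> - Phi \<nu> q\<close>: the tilted exponent there is
  \<open>laplace_exponent \<nu> \<gamma> - q\<close>, because the exponent at
  \<open>Phi \<nu> q\<close> equals \<open>q\<close>.\<close>

lemma (in usf_levy_measure) q_scale_power_series_sums:
  assumes q: "0 \<le> q" and V: "is_scale_function N Y (tilted (Phi \<nu> q) \<nu>) V"
    and \<gamma>: "Phi \<nu> q < \<gamma>" "Phi \<nu> q + largest_root (tilted (Phi \<nu> q) \<nu>) < \<gamma>"
  shows "(\<lambda>n. exp (Phi \<nu> q * (real n + 1)) * V (real n) * exp (- \<gamma>) ^ n)
           sums (exp \<gamma> / (laplace_exponent \<nu> \<gamma> - q))"
proof -
  define b where "b = Phi \<nu> q"
  define \<beta> where "\<beta> = \<gamma> - b"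
  have \<beta>: "0 < \<beta>" "largest_root (tilted b \<nu>) < \<beta>" using \<gamma> by (auto simp: \<beta>_def b_def)
  have V': "is_scale_function N Y (tilted b \<nu>) V" using V by (simp add: b_def)
  have \<psi>: "laplace_exponent (tilted b \<nu>) \<beta> = laplace_exponent \<nu> \<gamma> - q"
    using \<beta> Phi_nonneg[OF q] laplace_exponent_Phi[OF q]
    by (subst laplace_exponent_tilted) (auto simp: b_def \<beta>_def)
  have "(\<lambda>n. (1 - exp (- \<beta>)) / \<beta> * exp (- \<beta> * real n) * V (real n))
      sums (LINT x:{0..}|lborel. exp (- \<beta> * x) * V x)"
    by (rule floor_step_laplace_sums[where V = V and \<beta> = \<beta>, OF is_scale_function_floor[OF V']])
       (use V' \<beta> in \<open>auto simp: is_scale_function_def\<close>)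
  also have "(LINT x:{0..}|lborel. exp (- \<beta> * x) * V x)
      = (exp \<beta> - 1) / (\<beta> * (laplace_exponent \<nu> \<gamma> - q))"
    using V' \<beta> by (auto simp: is_scale_function_def \<psi>)
  \<comment> \<open>The multiplier cancels the integral of \<open>exp (- \<beta> * x)\<close> over
    the first cell and supplies the extra \<open>exp b\<close> that comes from the floor of
    \<open>1 + x\<close> in \<open>q_scale_W\<close>.\<close>
  finally have "(\<lambda>n. exp b * \<beta> / (1 - exp (- \<beta>)) *
        ((1 - exp (- \<beta>)) / \<beta> * exp (- \<beta> * real n) * V (real n)))
      sums (exp b * \<beta> / (1 - exp (- \<beta>)) * ((exp \<beta> - 1) / (\<beta> * (laplace_exponent \<nu> \<gamma> - q))))"
    by (rule sums_mult)
  also have "exp b * \<beta> / (1 - exp (- \<beta>)) * ((exp \<beta> - 1) / (\<beta> * (laplace_exponent \<nu> \<gamma> - q)))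
      = exp \<gamma> / (laplace_exponent \<nu> \<gamma> - q)"
  proof -
    have "exp \<gamma> = exp b * exp \<beta>" by (simp add: \<beta>_def exp_add[symmetric])
    moreover have "exp \<beta> - 1 = exp \<beta> * (1 - exp (- \<beta>))"
      by (simp add: right_diff_distrib exp_add[symmetric])
    moreover have "1 - exp (- \<beta>) \<noteq> 0" using \<beta> by simp
    ultimately show ?thesis using \<beta> by simp
  qed
  also have "(\<lambda>n. exp b * \<beta> / (1 - exp (- \<beta>)) *
        ((1 - exp (- \<beta>)) / \<beta> * exp (- \<beta> * real n) * V (real n)))
      = (\<lambda>n. exp (b * (real n + 1)) * V (real n) * exp (- \<gamma>) ^ n)"
  proof
    fix n
    have "exp b * exp (- \<beta> * real n) = exp (b * (real n + 1)) * exp (- \<gamma>) ^ n"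
      by (simp add: \<beta>_def exp_of_nat_mult[symmetric] exp_add[symmetric] algebra_simps)
    moreover have "1 - exp (- \<beta>) \<noteq> 0" using \<beta> by simp
    ultimately show "exp b * \<beta> / (1 - exp (- \<beta>)) *
        ((1 - exp (- \<beta>)) / \<beta> * exp (- \<beta> * real n) * V (real n))
      = exp (b * (real n + 1)) * V (real n) * exp (- \<gamma>) ^ n"
      using \<beta> by simp
  qed
  finally show ?thesis by (simp add: b_def)
qed

lemma (in usf_levy_measure) q_scale_renewal_equation:
  fixes V :: "real \<Rightarrow> real" and q :: real
  defines "w \<equiv> \<lambda>n. exp (Phi \<nu> q * (real n + 1)) * V (real n)"
  assumes q: "0 \<le> q" and V: "is_scale_function N Y (tilted (Phi \<nu> q) \<nu>) V"
  shows "measure \<nu> {1} * w n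
    = 1 + (\<Sum>k<n. (q + measure \<nu> {..- real (Suc k)}) * w (n - Suc k))"
proof -
  obtain B where B: "\<And>\<beta>. B < \<beta> \<Longrightarrow> q < laplace_exponent \<nu> \<beta>"
    using laplace_exponent_large by metis
  \<comment> \<open>For \<open>\<gamma> = - ln z > K\<close> all requirements hold at once: 0 gives
    \<open>z < 1\<close>, \<open>B\<close> makes the exponent exceed \<open>q\<close>, and the last
    two entries admit the normalization of the tilted chain.\<close>
  define K where "K = Max {0, B, Phi \<nu> q, Phi \<nu> q + largest_root (tilted (Phi \<nu> q) \<nu>)}"
  define \<psi> where "\<psi> z = laplace_exponent \<nu> (- ln z)" for z
  have *: "z = exp (- (- ln z))" "K < - ln z" "q < \<psi> z" "z < 1" if "0 < z" "z < exp (- K)" for z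
  proof -
    have "ln z < ln (exp (- K))" using that by (subst ln_less_cancel_iff) auto
    then show K: "K < - ln z" by simp
    then show "q < \<psi> z" unfolding \<psi>_def by (intro B) (simp add: K_def)
    have "exp (- K) \<le> 1" by (simp add: K_def)
    with that show "z < 1" by linarith
    show "z = exp (- (- ln z))" using that by simp
  qed
  show ?thesis
  proof (rule renewal_equation_from_power_series)
    show "0 < exp (- K)" by simp
    fix z :: real assume z: "0 < z" "z < exp (- K)"
    note z' = *[OF z]
    have exp\<gamma>: "exp (- ln z) = 1 / z" using z by (simp add: exp_minus field_simps)
    show "(\<lambda>n. w n * z ^ n) sums (1 / (z * (\<psi> z - q)))"
      using q_scale_power_series_sums[OF q V, of "- ln z"] z' z(1)
      unfolding w_def \<psi>_def[symmetric] exp\<gamma> by (simp add: K_def)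
    have "(\<lambda>k. measure \<nu> {..- real (Suc k)} * z ^ Suc k)
        sums (measure \<nu> {1} - \<psi> z / (1 / z - 1))"
      using tail_power_series_sums[of "- ln z"] z' z(1)
      unfolding \<psi>_def[symmetric] exp\<gamma> by simp
    moreover have "(\<lambda>k. q * z * z ^ k) sums (q * z * (1 / (1 - z)))"
      using z' z by (intro sums_mult geometric_sums) simp
    ultimately have "(\<lambda>k. measure \<nu> {..- real (Suc k)} * z ^ Suc k + q * z * z ^ k)
        sums (measure \<nu> {1} - \<psi> z / (1 / z - 1) + q * z * (1 / (1 - z)))"
      by (rule sums_add)
    then show "(\<lambda>k. (q + measure \<nu> {..- real (Suc k)}) * z ^ Suc k)
        sums (measure \<nu> {1} - \<psi> z / (1 / z - 1) + q * z * (1 / (1 - z)))"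
      by (simp add: algebra_simps)
    \<comment> \<open>The tail series and the series of \<open>q * z ^ Suc k\<close> combine so that
      \<open>l - g z\<close> is \<open>z * (\<psi> z - q) / (1 - z)\<close>, whose first two factors
      cancel against \<open>f z\<close>.\<close>
    have "\<psi> z / (1 / z - 1) = \<psi> z * z / (1 - z)" using z z' by (simp add: field_simps)
    then have "measure \<nu> {1} - (measure \<nu> {1} - \<psi> z / (1 / z - 1) + q * z * (1 / (1 - z)))
        = z * (\<psi> z - q) / (1 - z)"
      by (simp add: diff_divide_distrib algebra_simps)
    then show "(measure \<nu> {1} - (measure \<nu> {1} - \<psi> z / (1 / z - 1) + q * z * (1 / (1 - z))))
        * (1 / (z * (\<psi> z - q))) = 1 / (1 - z)"
      using z z' by simp
  qed
qed

section \<open>From the chain to the recursions\<close>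

text \<open>Almost every point lies in the support, so the restriction to the positive half-line is
  concentrated at 1. Its mass is positive because \<open>{0<..}\<close> is an open neighbourhood of
  the support point 1, and this mass is that of the atom.\<close>

lemma usf_levy_chain_imp_usf_levy_measure:
  assumes "usf_levy_chain M X \<nu>"
  shows "usf_levy_measure \<nu>"
proof -
  define \<nu>p where "\<nu>p = density \<nu> (indicator {0<..})"
  have sets [simp, measurable_cong]: "sets \<nu> = sets borel" and fin: "finite_measure \<nu>"
    and supp: "measure_support \<nu> \<subseteq> \<int>" "measure_support \<nu>p = {1}"
    using assms by (auto simp: usf_levy_chain_def compound_poisson_process_def \<nu>p_def)
  have \<nu>p: "emeasure \<nu>p A = emeasure \<nu> ({0<..} \<inter> A)" if "A \<in> sets borel" for A
    using that by (simp add: \<nu>p_def emeasure_density nn_integral_set_ennreal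
        indicator_inter_arith[symmetric] del: nn_integral_indicator)
       (simp add: nn_integral_indicator)
  have "AE x in \<nu>p. x = 1"
    using AE_in_measure_support[of \<nu>p] by (simp add: supp) (simp add: \<nu>p_def)
  then have pos: "AE x in \<nu>. 0 < x \<longrightarrow> x = 1"
    unfolding \<nu>p_def by (subst (asm) AE_density) (auto split: split_indicator_asm)
  have "0 < emeasure \<nu>p {0<..}"
  proof -
    have "1 \<in> measure_support \<nu>p" by (simp add: supp)
    then show ?thesis by (simp add: measure_support_def)
  qed
  also have "\<dots> = emeasure \<nu> {0<..}" by (simp add: \<nu>p)
  also have "\<dots> = emeasure \<nu> {1}"
    by (rule emeasure_eq_AE) (use pos in \<open>auto elim: eventually_mono\<close>)
  finally have "0 < measure \<nu> {1}"
    using finite_measure.emeasure_eq_measure[OF fin] by simp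
  moreover have "AE x in \<nu>. x \<in> \<int>"
    using AE_in_measure_support[OF sets] by eventually_elim (use supp(1) in auto)
  moreover have "AE x in \<nu>. x \<le> 1"
    using pos by eventually_elim linarith
  ultimately show ?thesis
    using fin sets by (simp add: usf_levy_measure_def usf_levy_measure_axioms_def)
qed

theorem corollary4p15:
  fixes M :: "'a measure" and X :: "real \<Rightarrow> 'a \<Rightarrow> real" and \<nu> :: "real measure" and q :: real
    and N :: "'b measure" and Y :: "real \<Rightarrow> 'b \<Rightarrow> real" and V W Z Zt :: "real \<Rightarrow> real"
  assumes X: "usf_levy_chain M X \<nu>"
    and q: "0 \<le> q"
    and Y: "usf_levy_chain N Y (tilted (Phi \<nu> q) \<nu>)"
    and V: "is_scale_function N Y (tilted (Phi \<nu> q) \<nu>) V"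
  defines "W \<equiv> q_scale_W \<nu> q V"
  defines "Z \<equiv> q_scale_Z q W"
  defines "Zt \<equiv> (\<lambda>x. Z x - 1)"
  shows "(\<forall>n::nat. W (real (n + 1)) = W 0 +
            (\<Sum>k = 1..n + 1. W (real (n + 1 - k)) *
               ((q + measure \<nu> {..- real k}) / measure \<nu> {1})))
       \<and> W 0 = 1 / measure \<nu> {1}
       \<and> (\<forall>n::nat. Zt (real (n + 1)) = real (n + 1) * (q / measure \<nu> {1}) +
            (\<Sum>k = 1..n. Zt (real (n + 1 - k)) *
               ((q + measure \<nu> {..- real k}) / measure \<nu> {1})))
       \<and> Zt 0 = 0"
proof -
  interpret usf_levy_measure \<nu>
    using X by (rule usf_levy_chain_imp_usf_levy_measure)
  define l where "l = measure \<nu> {1}"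
  define a where "a k = q + measure \<nu> {..- real (Suc k)}" for k
  define w where "w n = W (real n)" for n
  have l: "0 < l" using measure_1_pos by (simp add: l_def)
  have w_eq: "w n = exp (Phi \<nu> q * (real n + 1)) * V (real n)" for n
    by (simp add: w_def W_def q_scale_W_def add.commute)
  have renewal: "l * w n = 1 + (\<Sum>k<n. a k * w (n - Suc k))" for n
    unfolding w_eq l_def a_def by (rule q_scale_renewal_equation[OF q V])
  \<comment> \<open>Stated for all \<open>n\<close>: the case 0 has an empty sum and gives
    \<open>W 0\<close>, which then replaces \<open>1 / l\<close> in the case
    \<open>n + 1\<close>.\<close>
  have W_rec: "W (real n) = 1 / l + (\<Sum>k = 1..n. W (real (n - k)) * ((q + measure \<nu> {..- real k}) / l))"
    for n
  proof -
    have "w n = (l * w n) / l" using l by simp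
    also have "\<dots> = 1 / l + (\<Sum>k<n. w (n - Suc k) * (a k / l))"
      unfolding renewal by (simp add: add_divide_distrib sum_divide_distrib mult.commute)
    finally show ?thesis
      by (simp only: sum.atLeast1_atMost_eq a_def w_def One_nat_def)
  qed
  have W_floor: "W x = w (nat \<lfloor>x\<rfloor>)" if "0 \<le> x" for x
  proof -
    have "\<lfloor>1 + x\<rfloor> = \<lfloor>x\<rfloor> + 1" by linarith
    with that show ?thesis
      using is_scale_function_floor[OF V that] by (simp add: w_eq W_def q_scale_W_def)
  qed
  \<comment> \<open>\<open>W\<close> is constant on the cells, so its integral over
    \<open>[0, n]\<close> is a partial sum of \<open>w\<close>.\<close>
  have Zt: "Zt (real n) = q * (\<Sum>i<n. w i)" for n
    using floor_step_integral[of W "\<lambda>_. 1" w "\<lambda>x. x" n] W_floor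
    by (simp add: Zt_def Z_def q_scale_Z_def)
  have Zt_rec: "Zt (real (n + 1)) = real (n + 1) * (q / l) +
      (\<Sum>k = 1..n. Zt (real (n + 1 - k)) * ((q + measure \<nu> {..- real k}) / l))" for n
  proof -
    have "Zt (real (n + 1)) = q * (l * (\<Sum>i<Suc n. w i)) / l"
      using l Zt[of "Suc n"] by simp
    also have "\<dots> = real (n + 1) * (q / l) + (\<Sum>k<Suc n. Zt (real (n - k)) * (a k / l))"
      unfolding renewal_equation_partial_sums[OF renewal] Zt
      by (simp add: distrib_left add_divide_distrib sum_divide_distrib sum_distrib_left mult_ac
          del: sum.lessThan_Suc)
    \<comment> \<open>The last term contains \<open>Zt 0 = 0\<close>; this is why the sum for
      \<open>Zt\<close> stops at \<open>n\<close> while the one for \<open>W\<close> runs to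
      \<open>n + 1\<close>.\<close>
    also have "(\<Sum>k<Suc n. Zt (real (n - k)) * (a k / l)) = (\<Sum>k<n. Zt (real (n - k)) * (a k / l))"
      using Zt[of 0] by simp
    finally show ?thesis
      by (simp add: sum.atLeast1_atMost_eq a_def)
  qed
  have "W 0 = 1 / l" using W_rec[of 0] by simp
  moreover have "Zt 0 = 0" using Zt[of 0] by simp
  ultimately show ?thesis
    using W_rec Zt_rec unfolding l_def by metis
qed

end
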